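(* For every $N\ge 0$, the cardinality $|J_N^{\pm}|$ equals the number of ordered pairs of plane partitions of total degree $N$. The sequence $|J_N^\pm|$, $N=0,1,2,\dots$, begins $1,2,7,18,47,110,\dots$.
   Context: $J_N^\pm$ is the set of ordered pairs $(f,g)$ of finite multisets on the set $\mathbb N_{\ge1}\times\mathbb N_0$ (i.e. finitely supported functions $f,g:\mathbb N_{\ge1}\times\mathbb N_0\to\mathbb N_0$) of total degree $N$, meaning $\sum_{(p,q)}(f(p,q)+g(p,q))(p+q)=N$. (Elements $(p,q)$ are thought of as compositions with at most two parts. In the paper $J_N^\pm$ indexes the varieties of rank-$N$ charge-conserving loop braid representations up to symmetry.) The total degree of a pair of plane partitions is the sum of the two integers they partition. *)

theory Defs
  imports Main "HOL-Library.Multiset"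
begin

definition JNpm :: "nat \<Rightarrow> ((nat \<times> nat) multiset \<times> (nat \<times> nat) multiset) set" where
  "JNpm N = {(f, g). set_mset f \<subseteq> {1..} \<times> UNIV \<and> set_mset g \<subseteq> {1..} \<times> UNIV \<and>
     (\<Sum>(p, q) \<in> set_mset f \<union> set_mset g. (count f (p, q) + count g (p, q)) * (p + q)) = N}"

(* Arrays of naturals indexed from (0, 0); entries outside the shape of the plane partition are 0. *)
definition plane_partition :: "(nat \<Rightarrow> nat \<Rightarrow> nat) \<Rightarrow> bool" where
  "plane_partition \<pi> \<longleftrightarrow>
     finite {(i, j). \<pi> i j \<noteq> 0} \<and>
     (\<forall>i j. \<pi> (Suc i) j \<le> \<pi> i j \<and> \<pi> i (Suc j) \<le> \<pi> i j)"

definition pp_size :: "(nat \<Rightarrow> nat \<Rightarrow> nat) \<Rightarrow> nat" where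
  "pp_size \<pi> = (\<Sum>(i, j) \<in> {(i, j). \<pi> i j \<noteq> 0}. \<pi> i j)"

definition plane_partition_pairs ::
  "nat \<Rightarrow> ((nat \<Rightarrow> nat \<Rightarrow> nat) \<times> (nat \<Rightarrow> nat \<Rightarrow> nat)) set" where
  "plane_partition_pairs N =
     {(\<pi>, \<rho>). plane_partition \<pi> \<and> plane_partition \<rho> \<and> pp_size \<pi> + pp_size \<rho> = N}"

end

(* MacMahon's formula. The diagonals of a plane partition inside an n x n box form a chain of n up and
   n down steps of interlacing sequences from 0 to 0. Give each step a weight and charge it weight
   times change of size. A reflection inside the interlacing intervals turns "up a, down b" into
   "down b, up a" at the price of one free natural number k costing (a + b) * k. Moving all down steps
   to the front leaves only the trivial chain, so chains correspond to families of such numbers,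
   i.e. multisets on {1..n} x {0..<n}. *)
theory Submission imports Defs begin

section \<open>Weight-preserving bijections\<close>

text \<open>The weights turn cost into size. They are n, ..., 1 on the up steps and 0, ..., n - 1 on
  the down steps, so neighbouring weights differ by one, and Abel summation counts each diagonal
  exactly once; the main diagonal gets the last up weight 1 plus the first down weight 0. This also
  explains the index set: an up weight p \<ge> 1 passes a down weight q \<ge> 0 at cost p + q, the
  degree of (p, q). For each d there are d such pairs of degree d, matching the factor (1 -
  x^d)^(-d) of MacMahon's product.

  Bijections that preserve a weight replace generating functions: the degree stays open until the
  end, and products of sets play the part of products of series. No limit in n is taken, because in
  total degree N neither side leaves the box n = N.\<close>

definition weq :: "'a set \<Rightarrow> ('a \<Rightarrow> nat) \<Rightarrow> 'b set \<Rightarrow> ('b \<Rightarrow> nat) \<Rightarrow> bool" where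
  "weq A f B g \<longleftrightarrow> (\<exists>h. bij_betw h A B \<and> (\<forall>x\<in>A. g (h x) = f x))"

lemma weqI:
  assumes "\<And>x. x \<in> A \<Longrightarrow> h x \<in> B \<and> h' (h x) = x \<and> g (h x) = f x"
    and "\<And>y. y \<in> B \<Longrightarrow> h' y \<in> A \<and> h (h' y) = y"
  shows "weq A f B g"
  unfolding weq_def
  by (intro exI[of _ h] conjI bij_betw_byWitness[where f' = h']) (use assms in auto)

lemma weq_trans:
  assumes "weq A f B g" "weq B g C k"
  shows "weq A f C k"
proof -
  obtain h where h: "bij_betw h A B" "\<forall>x\<in>A. g (h x) = f x"
    using assms(1) unfolding weq_def by auto
  obtain h' where h': "bij_betw h' B C" "\<forall>x\<in>B. k (h' x) = g x"
    using assms(2) unfolding weq_def by auto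
  have "bij_betw (h' \<circ> h) A C"
    using h(1) h'(1) by (rule bij_betw_trans)
  moreover have "\<forall>x\<in>A. k ((h' \<circ> h) x) = f x"
    using h h' bij_betwE[OF h(1)] by auto
  ultimately show ?thesis
    unfolding weq_def by blast
qed

lemma weq_times:
  assumes "weq A f B g" "weq C f' D g'"
  shows "weq (A \<times> C) (\<lambda>(x, y). f x + f' y) (B \<times> D) (\<lambda>(x, y). g x + g' y)"
proof -
  obtain h where h: "bij_betw h A B" "\<forall>x\<in>A. g (h x) = f x"
    using assms(1) unfolding weq_def by auto
  obtain h' where h': "bij_betw h' C D" "\<forall>x\<in>C. g' (h' x) = f' x"
    using assms(2) unfolding weq_def by auto
  have "bij_betw (map_prod h h') (A \<times> C) (B \<times> D)"
    using h(1) h'(1) by (rule bij_betw_map_prod)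
  moreover have "\<forall>x\<in>A \<times> C. (case map_prod h h' x of (x, y) \<Rightarrow> g x + g' y) = (case x of (x, y) \<Rightarrow> f x + f' y)"
    using h h' by auto
  ultimately show ?thesis
    unfolding weq_def by blast
qed

lemma weq_refl: "weq A f A f"
  by (rule weqI[of _ id _ id]) auto

text \<open>Only here is a degree fixed; up to this point the sets are infinite and cardinalities
  would carry no information.\<close>

lemma weq_level_bij:
  assumes "weq A f B g"
  shows "\<exists>h. bij_betw h {x \<in> A. f x = N} {y \<in> B. g y = N}"
proof -
  obtain h where h: "bij_betw h A B" "\<forall>x\<in>A. g (h x) = f x"
    using assms unfolding weq_def by auto
  have "inj_on h {x \<in> A. f x = N}"
    using h(1) by (auto simp: bij_betw_def intro: inj_on_subset)
  moreover have "h ` {x \<in> A. f x = N} = {y \<in> B. g y = N}"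
    using h by (auto simp: bij_betw_def)
  ultimately show ?thesis
    by (auto simp: bij_betw_def)
qed

section \<open>Interlacing sequences\<close>

definition fin_supp :: "(nat \<Rightarrow> nat) \<Rightarrow> bool" where
  "fin_supp \<alpha> \<longleftrightarrow> (\<exists>m. \<forall>i\<ge>m. \<alpha> i = 0)"

text \<open>On infinite support \<open>sum\<close> returns 0, so statements about sizes are made
  under a finiteness assumption.\<close>

definition size_seq :: "(nat \<Rightarrow> nat) \<Rightarrow> nat" where
  "size_seq \<alpha> = sum \<alpha> {i. \<alpha> i \<noteq> 0}"

text \<open>This says that \<mu>/\<alpha> is a horizontal strip. Monotonicity is built in: the
  inequalities force both sequences to decrease weakly, so partitions need no type of their
  own.\<close>

definition interlace :: "(nat \<Rightarrow> nat) \<Rightarrow> (nat \<Rightarrow> nat) \<Rightarrow> bool" (infix "\<prec>" 50) where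
  "\<alpha> \<prec> \<mu> \<longleftrightarrow> (\<forall>i. \<mu> (Suc i) \<le> \<alpha> i \<and> \<alpha> i \<le> \<mu> i)"

lemma size_seq_eq:
  assumes "\<And>i. i \<ge> m \<Longrightarrow> \<alpha> i = 0"
  shows "size_seq \<alpha> = (\<Sum>i<m. \<alpha> i)"
  unfolding size_seq_def
proof (rule sum.mono_neutral_left)
  show "{i. \<alpha> i \<noteq> 0} \<subseteq> {..<m}"
  proof
    fix i assume "i \<in> {i. \<alpha> i \<noteq> 0}"
    then show "i \<in> {..<m}" using assms[of i] by (cases "i < m") auto
  qed
qed auto

lemma size_seq_zero [simp]: "size_seq (\<lambda>_. 0) = 0"
  by (simp add: size_seq_def)

text \<open>Finiteness spreads along a chain in both directions, so it suffices to require it of the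
  start.\<close>

lemma interlace_fin_supp:
  assumes "\<alpha> \<prec> \<mu>"
  shows "fin_supp \<alpha> \<longleftrightarrow> fin_supp \<mu>"
proof
  assume "fin_supp \<alpha>"
  then obtain m where "\<forall>i\<ge>m. \<alpha> i = 0" by (auto simp: fin_supp_def)
  then have "\<forall>i\<ge>Suc m. \<mu> i = 0"
    using assms unfolding interlace_def by (metis Suc_le_D Suc_le_mono le_zero_eq)
  then show "fin_supp \<mu>" by (auto simp: fin_supp_def)
next
  assume "fin_supp \<mu>"
  then show "fin_supp \<alpha>"
    using assms unfolding interlace_def fin_supp_def by (metis le_zero_eq)
qed

lemma size_seq_mono:
  assumes "\<alpha> \<prec> \<mu>" "fin_supp \<mu>"
  shows "size_seq \<alpha> \<le> size_seq \<mu>"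
proof -
  obtain m where m: "\<forall>i\<ge>m. \<mu> i = 0" using assms(2) by (auto simp: fin_supp_def)
  have "size_seq \<mu> = (\<Sum>i<m. \<mu> i)" by (rule size_seq_eq) (use m in auto)
  moreover have "size_seq \<alpha> = (\<Sum>i<m. \<alpha> i)"
    by (rule size_seq_eq) (use m assms in \<open>auto simp: interlace_def\<close>, metis le_zero_eq)
  ultimately show ?thesis
    using assms(1) by (auto intro: sum_mono simp: interlace_def)
qed

lemma interlace_zero_iff: "\<kappa> \<prec> (\<lambda>_. 0) \<longleftrightarrow> \<kappa> = (\<lambda>_. 0)"
  by (auto simp: interlace_def fun_eq_iff)

text \<open>If \<open>\<mu>\<close> interlaces both \<open>\<alpha>\<close> and \<open>\<nu>\<close> from above, \<open>\<mu> (Suc i)\<close> ranges over the same interval as \<open>\<kappa> i\<close>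
  for a \<open>\<kappa>\<close> interlacing both from below; reflecting that interval leaves only \<open>\<mu> 0\<close> as a free parameter.\<close>

definition reflect_down :: "(nat \<Rightarrow> nat) \<Rightarrow> (nat \<Rightarrow> nat) \<Rightarrow> (nat \<Rightarrow> nat) \<Rightarrow> nat \<Rightarrow> nat" where
  "reflect_down \<alpha> \<nu> \<mu> i = max (\<alpha> (Suc i)) (\<nu> (Suc i)) + min (\<alpha> i) (\<nu> i) - \<mu> (Suc i)"

definition reflect_up :: "(nat \<Rightarrow> nat) \<Rightarrow> (nat \<Rightarrow> nat) \<Rightarrow> (nat \<Rightarrow> nat) \<Rightarrow> nat \<Rightarrow> nat \<Rightarrow> nat" where
  "reflect_up \<alpha> \<nu> \<kappa> k i = (case i of 0 \<Rightarrow> max (\<alpha> 0) (\<nu> 0) + k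
     | Suc j \<Rightarrow> max (\<alpha> (Suc j)) (\<nu> (Suc j)) + min (\<alpha> j) (\<nu> j) - \<kappa> j)"

text \<open>The interval from the larger of \<alpha> (Suc i), \<nu> (Suc i) to the smaller of
  \<alpha> i, \<nu> i contains \<mu> (Suc i); the map x to max + min - x preserves it, and truncated
  subtraction is exact there.\<close>

lemma reflect_down_interlace:
  assumes "\<alpha> \<prec> \<mu>" "\<nu> \<prec> \<mu>"
  shows "reflect_down \<alpha> \<nu> \<mu> \<prec> \<alpha>" "reflect_down \<alpha> \<nu> \<mu> \<prec> \<nu>"
proof -
  have *: "\<alpha> (Suc i) \<le> \<mu> (Suc i)" "\<nu> (Suc i) \<le> \<mu> (Suc i)" "\<mu> (Suc i) \<le> \<alpha> i" "\<mu> (Suc i) \<le> \<nu> i" for i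
    using assms by (auto simp: interlace_def)
  have "\<alpha> (Suc i) \<le> reflect_down \<alpha> \<nu> \<mu> i \<and> reflect_down \<alpha> \<nu> \<mu> i \<le> \<alpha> i \<and>
        \<nu> (Suc i) \<le> reflect_down \<alpha> \<nu> \<mu> i \<and> reflect_down \<alpha> \<nu> \<mu> i \<le> \<nu> i" for i
    using *[of i] by (auto simp: reflect_down_def)
  then show "reflect_down \<alpha> \<nu> \<mu> \<prec> \<alpha>" "reflect_down \<alpha> \<nu> \<mu> \<prec> \<nu>"
    by (auto simp: interlace_def)
qed

lemma reflect_up_interlace:
  assumes "\<kappa> \<prec> \<alpha>" "\<kappa> \<prec> \<nu>"
  shows "\<alpha> \<prec> reflect_up \<alpha> \<nu> \<kappa> k" "\<nu> \<prec> reflect_up \<alpha> \<nu> \<kappa> k"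
proof -
  have *: "\<alpha> (Suc i) \<le> \<kappa> i" "\<nu> (Suc i) \<le> \<kappa> i" "\<kappa> i \<le> \<alpha> i" "\<kappa> i \<le> \<nu> i" for i
    using assms by (auto simp: interlace_def)
  have "reflect_up \<alpha> \<nu> \<kappa> k (Suc i) \<le> \<alpha> i \<and> \<alpha> i \<le> reflect_up \<alpha> \<nu> \<kappa> k i \<and>
        reflect_up \<alpha> \<nu> \<kappa> k (Suc i) \<le> \<nu> i \<and> \<nu> i \<le> reflect_up \<alpha> \<nu> \<kappa> k i" for i
    using *[of i] *[of "i - 1"] by (cases i) (auto simp: reflect_up_def)
  then show "\<alpha> \<prec> reflect_up \<alpha> \<nu> \<kappa> k" "\<nu> \<prec> reflect_up \<alpha> \<nu> \<kappa> k"
    by (auto simp: interlace_def)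
qed

lemma reflect_down_up:
  assumes "\<kappa> \<prec> \<alpha>" "\<kappa> \<prec> \<nu>"
  shows "reflect_down \<alpha> \<nu> (reflect_up \<alpha> \<nu> \<kappa> k) = \<kappa>"
proof
  fix i
  have "\<alpha> (Suc i) \<le> \<kappa> i" "\<nu> (Suc i) \<le> \<kappa> i" "\<kappa> i \<le> \<alpha> i" "\<kappa> i \<le> \<nu> i"
    using assms by (auto simp: interlace_def)
  then show "reflect_down \<alpha> \<nu> (reflect_up \<alpha> \<nu> \<kappa> k) i = \<kappa> i"
    by (auto simp: reflect_up_def reflect_down_def)
qed

lemma reflect_up_zero: "reflect_up \<alpha> \<nu> \<kappa> k 0 - max (\<alpha> 0) (\<nu> 0) = k"
  by (simp add: reflect_up_def)

lemma reflect_up_down: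
  assumes "\<alpha> \<prec> \<mu>" "\<nu> \<prec> \<mu>"
  shows "reflect_up \<alpha> \<nu> (reflect_down \<alpha> \<nu> \<mu>) (\<mu> 0 - max (\<alpha> 0) (\<nu> 0)) = \<mu>"
proof
  fix i
  have *: "\<alpha> i \<le> \<mu> i" "\<nu> i \<le> \<mu> i" "\<mu> (Suc i) \<le> \<alpha> i" "\<mu> (Suc i) \<le> \<nu> i" for i
    using assms by (auto simp: interlace_def)
  show "reflect_up \<alpha> \<nu> (reflect_down \<alpha> \<nu> \<mu>) (\<mu> 0 - max (\<alpha> 0) (\<nu> 0)) i = \<mu> i"
    using *[of i] *[of "i - 1"] by (cases i) (auto simp: reflect_up_def reflect_down_def)
qed

text \<open>Reflection gives \<mu> (Suc i) + \<kappa> i as a maximum at Suc i plus a minimum at i.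
  Summed over i, maxima and minima recombine into \<alpha> + \<nu>, except that the maximum at 0 is
  missing while \<mu> 0 is left over.\<close>

lemma size_reflect_down:
  assumes "\<alpha> \<prec> \<mu>" "\<nu> \<prec> \<mu>" "fin_supp \<mu>"
  shows "size_seq \<mu> + size_seq (reflect_down \<alpha> \<nu> \<mu>) = size_seq \<alpha> + size_seq \<nu> + (\<mu> 0 - max (\<alpha> 0) (\<nu> 0))"
proof -
  let ?\<kappa> = "reflect_down \<alpha> \<nu> \<mu>"
  have *: "\<alpha> i \<le> \<mu> i" "\<nu> i \<le> \<mu> i" "\<mu> (Suc i) \<le> \<alpha> i" "\<mu> (Suc i) \<le> \<nu> i" for i
    using assms by (auto simp: interlace_def)
  obtain m where m: "\<And>i. i \<ge> m \<Longrightarrow> \<mu> i = 0"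
    using assms(3) by (auto simp: fin_supp_def)
  have z: "\<alpha> i = 0" "\<nu> i = 0" "?\<kappa> i = 0" if "i \<ge> m" for i
    using *[of i] m[OF that] m[of "Suc i"] *[of "Suc i"] that by (auto simp: reflect_down_def)
  have local_rule: "\<mu> (Suc i) + ?\<kappa> i = max (\<alpha> (Suc i)) (\<nu> (Suc i)) + min (\<alpha> i) (\<nu> i)" for i
    using *[of i] by (auto simp: reflect_down_def)
  have "size_seq \<mu> = (\<Sum>i<Suc m. \<mu> i)" "size_seq ?\<kappa> = (\<Sum>i<m. ?\<kappa> i)"
    "size_seq \<alpha> = (\<Sum>i<Suc m. \<alpha> i)" "size_seq \<nu> = (\<Sum>i<Suc m. \<nu> i)"
    by (rule size_seq_eq; use m z in simp)+
  then have "size_seq \<mu> + size_seq ?\<kappa> = \<mu> 0 + (\<Sum>i<m. \<mu> (Suc i) + ?\<kappa> i)"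
    by (simp add: sum.lessThan_Suc_shift sum.distrib del: sum.lessThan_Suc)
  also have "\<dots> = \<mu> 0 + (\<Sum>i<m. max (\<alpha> (Suc i)) (\<nu> (Suc i))) + (\<Sum>i<m. min (\<alpha> i) (\<nu> i))"
    by (simp add: local_rule sum.distrib)
  \<comment> \<open>Adding the maximum at 0 completes the shifted sum; the new minimum at m is
    0.\<close>
  also have "\<dots> + max (\<alpha> 0) (\<nu> 0) = \<mu> 0 + (\<Sum>i<Suc m. max (\<alpha> i) (\<nu> i)) + (\<Sum>i<Suc m. min (\<alpha> i) (\<nu> i))"
    unfolding sum.lessThan_Suc_shift[of "\<lambda>i. max (\<alpha> i) (\<nu> i)"] using z[of m] by simp
  also have "\<dots> = \<mu> 0 + (\<Sum>i<Suc m. max (\<alpha> i) (\<nu> i) + min (\<alpha> i) (\<nu> i))"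
    by (simp add: sum.distrib)
  also have "\<dots> = \<mu> 0 + (\<Sum>i<Suc m. \<alpha> i + \<nu> i)"
  proof -
    have "max (\<alpha> i) (\<nu> i) + min (\<alpha> i) (\<nu> i) = \<alpha> i + \<nu> i" for i by simp
    then show ?thesis by (simp only:)
  qed
  also have "\<dots> = \<mu> 0 + size_seq \<alpha> + size_seq \<nu>"
    using \<open>size_seq \<alpha> = _\<close> \<open>size_seq \<nu> = _\<close> by (simp add: sum.distrib)
  finally show ?thesis
    using *[of 0] by linarith
qed

section \<open>Chains of interlacing sequences\<close>

datatype step = Up nat | Down nat

fun step_rel :: "step \<Rightarrow> (nat \<Rightarrow> nat) \<Rightarrow> (nat \<Rightarrow> nat) \<Rightarrow> bool" where
  "step_rel (Up a) \<alpha> \<beta> \<longleftrightarrow> \<alpha> \<prec> \<beta>"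
| "step_rel (Down b) \<alpha> \<beta> \<longleftrightarrow> \<beta> \<prec> \<alpha>"

fun step_cost :: "step \<Rightarrow> (nat \<Rightarrow> nat) \<Rightarrow> (nat \<Rightarrow> nat) \<Rightarrow> nat" where
  "step_cost (Up a) \<alpha> \<beta> = a * (size_seq \<beta> - size_seq \<alpha>)"
| "step_cost (Down b) \<alpha> \<beta> = b * (size_seq \<alpha> - size_seq \<beta>)"

text \<open>The start is a parameter and not an entry of the list, and only the end is forced to be
  0: rewriting inside a word leads to chains that start at an arbitrary sequence.\<close>

fun is_chain :: "(nat \<Rightarrow> nat) \<Rightarrow> step list \<Rightarrow> (nat \<Rightarrow> nat) list \<Rightarrow> bool" where
  "is_chain \<alpha> [] ps \<longleftrightarrow> \<alpha> = (\<lambda>_. 0) \<and> ps = []"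
| "is_chain \<alpha> (s # w) ps \<longleftrightarrow> (\<exists>\<beta> qs. ps = \<beta> # qs \<and> step_rel s \<alpha> \<beta> \<and> is_chain \<beta> w qs)"

fun cost :: "(nat \<Rightarrow> nat) \<Rightarrow> step list \<Rightarrow> (nat \<Rightarrow> nat) list \<Rightarrow> nat" where
  "cost \<alpha> (s # w) (\<beta> # qs) = step_cost s \<alpha> \<beta> + cost \<beta> w qs"
| "cost \<alpha> _ _ = 0"

abbreviation chains :: "(nat \<Rightarrow> nat) \<Rightarrow> step list \<Rightarrow> (nat \<Rightarrow> nat) list set" where
  "chains \<alpha> w \<equiv> {ps. is_chain \<alpha> w ps}"

lemma step_rel_fin_supp: "step_rel s \<alpha> \<beta> \<Longrightarrow> fin_supp \<alpha> \<Longrightarrow> fin_supp \<beta>"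
  by (cases s) (auto simp: interlace_fin_supp)

text \<open>Both the rise to \<mu> and the fall from it exceed their counterparts through \<kappa>
  by the same k. Each weight stays with its step, hence the surplus (a + b) * k.\<close>

lemma swap_cost:
  assumes "\<alpha> \<prec> \<mu>" "\<nu> \<prec> \<mu>" "fin_supp \<alpha>"
  shows "step_cost (Down b) \<alpha> (reflect_down \<alpha> \<nu> \<mu>) + step_cost (Up a) (reflect_down \<alpha> \<nu> \<mu>) \<nu>
           + (a + b) * (\<mu> 0 - max (\<alpha> 0) (\<nu> 0)) = step_cost (Up a) \<alpha> \<mu> + step_cost (Down b) \<mu> \<nu>"
proof -
  let ?\<kappa> = "reflect_down \<alpha> \<nu> \<mu>" and ?k = "\<mu> 0 - max (\<alpha> 0) (\<nu> 0)"
  have fin: "fin_supp \<mu>" "fin_supp \<nu>"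
    using assms interlace_fin_supp by blast+
  note le = size_seq_mono[OF reflect_down_interlace(1)[OF assms(1,2)] assms(3)]
    size_seq_mono[OF reflect_down_interlace(2)[OF assms(1,2)] fin(2)]
  have "size_seq \<mu> - size_seq \<alpha> = (size_seq \<nu> - size_seq ?\<kappa>) + ?k"
    "size_seq \<mu> - size_seq \<nu> = (size_seq \<alpha> - size_seq ?\<kappa>) + ?k"
    using size_reflect_down[OF assms(1,2) fin(1)] le by linarith+
  then show ?thesis
    by (simp only: step_cost.simps distrib_left distrib_right add.assoc add.left_commute add.commute)
qed

text \<open>Bijective form of the commutation relation of half vertex operators; the free k stands
  for the geometric series 1 / (1 - x^(a + b)).\<close>

lemma weq_swap:
  assumes "fin_supp \<alpha>"
  shows "weq (chains \<alpha> (Up a # Down b # w)) (cost \<alpha> (Up a # Down b # w))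
             (chains \<alpha> (Down b # Up a # w) \<times> UNIV)
             (\<lambda>(ps, k). cost \<alpha> (Down b # Up a # w) ps + (a + b) * k)"
proof (rule weqI)
  fix ps assume "ps \<in> chains \<alpha> (Up a # Down b # w)"
  then obtain \<mu> \<nu> qs where ps: "ps = \<mu> # \<nu> # qs" "\<alpha> \<prec> \<mu>" "\<nu> \<prec> \<mu>" "is_chain \<nu> w qs" by auto
  \<comment> \<open>Entry 0 is the middle sequence to be replaced; entry 1 is \<nu>, which
    \<open>tl\<close> retains together with the rest.\<close>
  let ?h = "\<lambda>ps. (reflect_down \<alpha> (ps ! 1) (ps ! 0) # tl ps, (ps ! 0) 0 - max (\<alpha> 0) ((ps ! 1) 0))"
  let ?h' = "\<lambda>(ps, k). reflect_up \<alpha> (ps ! 1) (ps ! 0) k # tl ps"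
  show "?h ps \<in> chains \<alpha> (Down b # Up a # w) \<times> UNIV \<and> ?h' (?h ps) = ps \<and>
     (case ?h ps of (ps, k) \<Rightarrow> cost \<alpha> (Down b # Up a # w) ps + (a + b) * k) = cost \<alpha> (Up a # Down b # w) ps"
    using ps swap_cost[OF ps(2,3) assms, of b a]
    by (simp add: reflect_up_down reflect_down_interlace)
next
  fix y :: "(nat \<Rightarrow> nat) list \<times> nat"
  assume "y \<in> chains \<alpha> (Down b # Up a # w) \<times> UNIV"
  then obtain \<kappa> \<nu> qs k where y: "y = (\<kappa> # \<nu> # qs, k)" "\<kappa> \<prec> \<alpha>" "\<kappa> \<prec> \<nu>" "is_chain \<nu> w qs" by auto
  let ?h = "\<lambda>ps. (reflect_down \<alpha> (ps ! 1) (ps ! 0) # tl ps, (ps ! 0) 0 - max (\<alpha> 0) ((ps ! 1) 0))"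
  let ?h' = "\<lambda>(ps, k). reflect_up \<alpha> (ps ! 1) (ps ! 0) k # tl ps"
  show "?h' y \<in> chains \<alpha> (Up a # Down b # w) \<and> ?h (?h' y) = y"
    using y by (simp add: reflect_up_interlace reflect_down_up reflect_up_zero)
qed

text \<open>Lets a rewriting act behind the first step. The bijection may depend on \<beta>, which
  the head of the list remembers, but M and g may not, so that the factor M splits off.\<close>

lemma weq_chain_Cons:
  assumes "\<And>\<beta>. step_rel s \<alpha> \<beta> \<Longrightarrow>
    weq (chains \<beta> w) (cost \<beta> w) (chains \<beta> w' \<times> M) (\<lambda>(ps, m). cost \<beta> w' ps + g m)"
  shows "weq (chains \<alpha> (s # w)) (cost \<alpha> (s # w)) (chains \<alpha> (s # w') \<times> M)
     (\<lambda>(ps, m). cost \<alpha> (s # w') ps + g m)"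
proof -
  \<comment> \<open>The premise on \<beta> is moved under the existential so that choice yields one
    family h.\<close>
  have "\<exists>h. step_rel s \<alpha> \<beta> \<longrightarrow> bij_betw h (chains \<beta> w) (chains \<beta> w' \<times> M) \<and>
      (\<forall>ps\<in>chains \<beta> w. (case h ps of (ps, m) \<Rightarrow> cost \<beta> w' ps + g m) = cost \<beta> w ps)" for \<beta>
    using assms[of \<beta>] unfolding weq_def by blast
  then obtain h where h: "\<And>\<beta>. step_rel s \<alpha> \<beta> \<Longrightarrow> bij_betw (h \<beta>) (chains \<beta> w) (chains \<beta> w' \<times> M)"
    "\<And>\<beta> ps. step_rel s \<alpha> \<beta> \<Longrightarrow> is_chain \<beta> w ps \<Longrightarrow>
      (case h \<beta> ps of (ps, m) \<Rightarrow> cost \<beta> w' ps + g m) = cost \<beta> w ps"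
    by (metis mem_Collect_eq)
  define h' where "h' \<beta> = inv_into (chains \<beta> w) (h \<beta>)" for \<beta>
  have hh: "h \<beta> qs \<in> chains \<beta> w' \<times> M \<and> h' \<beta> (h \<beta> qs) = qs" if "step_rel s \<alpha> \<beta>" "is_chain \<beta> w qs" for \<beta> qs
    using h(1)[OF that(1)] that(2) bij_betwE unfolding h'_def
    by (fastforce simp: bij_betw_def)
  have hh': "is_chain \<beta> w (h' \<beta> y) \<and> h \<beta> (h' \<beta> y) = y" if "step_rel s \<alpha> \<beta>" "y \<in> chains \<beta> w' \<times> M" for \<beta> y
    using h(1)[OF that(1)] that(2) unfolding h'_def
    by (metis bij_betw_def f_inv_into_f inv_into_into mem_Collect_eq)
  let ?h = "\<lambda>ps. map_prod ((#) (hd ps)) id (h (hd ps) (tl ps))"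
  let ?h' = "\<lambda>(ps, m). hd ps # h' (hd ps) (tl ps, m)"
  show ?thesis
  proof (rule weqI[where h = ?h and h' = ?h'])
    fix ps assume "ps \<in> chains \<alpha> (s # w)"
    then obtain \<beta> qs where ps: "ps = \<beta> # qs" "step_rel s \<alpha> \<beta>" "is_chain \<beta> w qs" by auto
    show "?h ps \<in> chains \<alpha> (s # w') \<times> M \<and> ?h' (?h ps) = ps \<and>
      (case ?h ps of (ps, m) \<Rightarrow> cost \<alpha> (s # w') ps + g m) = cost \<alpha> (s # w) ps"
      using hh[OF ps(2,3)] h(2)[OF ps(2,3)] ps by (cases "h \<beta> qs") auto
  next
    fix y assume "y \<in> chains \<alpha> (s # w') \<times> M"
    then obtain \<beta> qs m where y: "y = (\<beta> # qs, m)" "step_rel s \<alpha> \<beta>" "is_chain \<beta> w' qs" "m \<in> M" by auto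
    show "?h' y \<in> chains \<alpha> (s # w) \<and> ?h (?h' y) = y"
      using hh'[OF y(2), of "(qs, m)"] y by auto
  qed
qed

section \<open>Multisets of pairs\<close>

definition weight :: "(nat \<times> nat) multiset \<Rightarrow> nat" where
  "weight M = (\<Sum>(p, q)\<in>#M. p + q)"

abbreviation msets :: "'a set \<Rightarrow> 'a multiset set" where
  "msets A \<equiv> {M. set_mset M \<subseteq> A}"

lemma weight_simps [simp]:
  "weight {#} = 0"
  "weight (add_mset (p, q) M) = p + q + weight M"
  "weight (M + M') = weight M + weight M'"
  "weight (replicate_mset k (p, q)) = (p + q) * k"
  by (simp_all add: weight_def)

lemma weq_msets_Un:
  assumes "A \<inter> B = {}"
  shows "weq (msets A \<times> msets B) (\<lambda>(M, M'). weight M + weight M') (msets (A \<union> B)) weight"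
proof (rule weqI[where h = "\<lambda>(M, M'). M + M'" and h' = "\<lambda>M. (filter_mset (\<lambda>x. x \<in> A) M, filter_mset (\<lambda>x. x \<notin> A) M)"])
  fix x :: "(nat \<times> nat) multiset \<times> (nat \<times> nat) multiset"
  assume "x \<in> msets A \<times> msets B"
  then obtain M M' where x: "x = (M, M')" "set_mset M \<subseteq> A" "set_mset M' \<subseteq> B" by auto
  have "filter_mset (\<lambda>x. x \<in> A) M = filter_mset (\<lambda>_. True) M" "filter_mset (\<lambda>x. x \<in> A) M' = filter_mset (\<lambda>_. False) M'"
    "filter_mset (\<lambda>x. x \<notin> A) M = filter_mset (\<lambda>_. False) M" "filter_mset (\<lambda>x. x \<notin> A) M' = filter_mset (\<lambda>_. True) M'"
    by (rule filter_mset_cong; use x assms in auto)+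
  then show "(case x of (M, M') \<Rightarrow> M + M') \<in> msets (A \<union> B) \<and>
      (filter_mset (\<lambda>x. x \<in> A) (case x of (M, M') \<Rightarrow> M + M'), filter_mset (\<lambda>x. x \<notin> A) (case x of (M, M') \<Rightarrow> M + M')) = x \<and>
      weight (case x of (M, M') \<Rightarrow> M + M') = (case x of (M, M') \<Rightarrow> weight M + weight M')"
    using x by auto
qed (auto simp: multiset_partition[symmetric])

text \<open>The number k released by a swap is read as the multiplicity of the pair of weights that
  met.\<close>

lemma weq_nat_msets: "weq UNIV (\<lambda>k. (p + q) * k) (msets {(p, q)}) weight"
proof (rule weqI[where h = "\<lambda>k. replicate_mset k (p, q)" and h' = size])
  fix M :: "(nat \<times> nat) multiset" assume "M \<in> msets {(p, q)}"
  then show "size M \<in> UNIV \<and> replicate_mset (size M) (p, q) = M"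
    using set_mset_subset_singletonD[of M "(p, q)"] by auto
qed auto

section \<open>Commuting all down steps to the front\<close>

text \<open>\<open>Down b\<close> first passes \<open>as\<close> behind \<open>Up a\<close>, by
  induction from an arbitrary start, and then swaps with \<open>Up a\<close> itself. Each passage
  fixes the multiplicity of one pair.\<close>

lemma weq_move_down:
  assumes "fin_supp \<alpha>" "distinct as"
  shows "weq (chains \<alpha> (map Up as @ Down b # w)) (cost \<alpha> (map Up as @ Down b # w))
     (chains \<alpha> (Down b # map Up as @ w) \<times> msets (set as \<times> {b}))
     (\<lambda>(ps, M). cost \<alpha> (Down b # map Up as @ w) ps + weight M)"
  using assms
proof (induction as arbitrary: \<alpha>)
  case Nil
  show ?case
    by (rule weqI[where h = "\<lambda>ps. (ps, {#})" and h' = fst]) auto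
next
  case (Cons a as)
  let ?w = "map Up as @ w" and ?M = "msets (set as \<times> {b})"
  have 1: "weq (chains \<alpha> (Up a # map Up as @ Down b # w)) (cost \<alpha> (Up a # map Up as @ Down b # w))
      (chains \<alpha> (Up a # Down b # ?w) \<times> ?M) (\<lambda>(ps, M). cost \<alpha> (Up a # Down b # ?w) ps + weight M)"
    by (rule weq_chain_Cons) (use Cons step_rel_fin_supp in \<open>auto simp del: step_rel.simps\<close>)
  have 2: "weq (chains \<alpha> (Up a # Down b # ?w) \<times> ?M) (\<lambda>(ps, M). cost \<alpha> (Up a # Down b # ?w) ps + weight M)
      ((chains \<alpha> (Down b # Up a # ?w) \<times> UNIV) \<times> ?M)
      (\<lambda>(x, M). (case x of (ps, k) \<Rightarrow> cost \<alpha> (Down b # Up a # ?w) ps + (a + b) * k) + weight M)"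
    by (rule weq_times[OF weq_swap[OF Cons.prems(1)] weq_refl])
  have 3: "weq ((chains \<alpha> (Down b # Up a # ?w) \<times> UNIV) \<times> ?M)
      (\<lambda>(x, M). (case x of (ps, k) \<Rightarrow> cost \<alpha> (Down b # Up a # ?w) ps + (a + b) * k) + weight M)
      (chains \<alpha> (Down b # Up a # ?w) \<times> (UNIV \<times> ?M))
      (\<lambda>(ps, x). cost \<alpha> (Down b # Up a # ?w) ps + (case x of (k, M) \<Rightarrow> (a + b) * k + weight M))"
    by (rule weqI[where h = "\<lambda>((ps, k), M). (ps, k, M)" and h' = "\<lambda>(ps, k, M). ((ps, k), M)"]) auto
  have "weq (UNIV \<times> ?M) (\<lambda>(k, M). (a + b) * k + weight M)
      (msets {(a, b)} \<times> ?M) (\<lambda>(M, M'). weight M + weight M')"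
    by (rule weq_times[OF weq_nat_msets weq_refl])
  \<comment> \<open>Distinct up weights keep the new pair apart from those already
    collected.\<close>
  also have "{(a, b)} \<inter> set as \<times> {b} = {}" using Cons.prems by auto
  note weq_msets_Un[OF this]
  finally (weq_trans) have 4: "weq (UNIV \<times> ?M) (\<lambda>(k, M). (a + b) * k + weight M)
      (msets (set (a # as) \<times> {b})) weight"
    by simp
  show ?case
    using weq_trans[OF weq_trans[OF 1 2] weq_trans[OF 3 weq_times[OF weq_refl 4]]] by simp
qed

text \<open>Only 0 interlaces below 0, so the final 0 propagates back through all the up
  steps.\<close>

lemma chains_Up_zero: "ps \<in> chains \<alpha> (map Up as) \<longleftrightarrow> \<alpha> = (\<lambda>_. 0) \<and> ps = map (\<lambda>_ _. 0) as"
proof (induction as arbitrary: \<alpha> ps)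
  case (Cons a as)
  then show ?case by (auto simp: interlace_zero_iff)
qed auto

lemma cost_Up_zero: "cost (\<lambda>_. 0) (map Up as) (map (\<lambda>_ _. 0) as) = 0"
  by (induction as) auto

lemma weq_chains_msets:
  assumes "distinct as" "distinct bs"
  shows "weq (chains (\<lambda>_. 0) (map Up as @ map Down bs)) (cost (\<lambda>_. 0) (map Up as @ map Down bs))
     (msets (set as \<times> set bs)) weight"
  using assms(2)
proof (induction bs)
  case Nil
  show ?case
    by (rule weqI[where h = "\<lambda>_. {#}" and h' = "\<lambda>_. map (\<lambda>_ _. 0) as"])
      (use chains_Up_zero in \<open>auto simp: cost_Up_zero\<close>)
next
  case (Cons b bs)
  let ?w = "map Up as @ map Down bs" and ?o = "\<lambda>_. 0"
  have 1: "weq (chains ?o (map Up as @ Down b # map Down bs)) (cost ?o (map Up as @ Down b # map Down bs))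
     (chains ?o (Down b # ?w) \<times> msets (set as \<times> {b})) (\<lambda>(ps, M). cost ?o (Down b # ?w) ps + weight M)"
    by (rule weq_move_down) (use assms in \<open>auto simp: fin_supp_def\<close>)
  \<comment> \<open>A down step from 0 can only reach 0 and costs nothing, so at the front it can be
    deleted.\<close>
  have 2: "weq (chains ?o (Down b # ?w)) (cost ?o (Down b # ?w)) (chains ?o ?w) (cost ?o ?w)"
    by (rule weqI[where h = tl and h' = "\<lambda>ps. ?o # ps"]) (auto simp: interlace_zero_iff)
  have 3: "weq (chains ?o (Down b # ?w)) (cost ?o (Down b # ?w)) (msets (set as \<times> set bs)) weight"
    using weq_trans[OF 2] Cons by simp
  have "set as \<times> set bs \<inter> set as \<times> {b} = {}" "set as \<times> set bs \<union> set as \<times> {b} = set as \<times> set (b # bs)"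
    using Cons.prems by auto
  then have "weq (msets (set as \<times> set bs) \<times> msets (set as \<times> {b})) (\<lambda>(M, M'). weight M + weight M')
      (msets (set as \<times> set (b # bs))) weight"
    using weq_msets_Un by metis
  from weq_trans[OF 1 weq_trans[OF weq_times[OF 3 weq_refl] this]] show ?case
    by simp
qed

section \<open>Plane partitions as chains of diagonals\<close>

text \<open>With these weights the cost of a chain telescopes to the sum of the sizes of all its members.\<close>

abbreviation box_word :: "nat \<Rightarrow> step list" where
  "box_word n \<equiv> map Up (rev [1..<Suc n]) @ map Down [0..<n]"

text \<open>Each later sequence is charged -c as the end of one step and c + 1 as the start of the
  next; the last one is 0, so no boundary term remains. The offset c is general because it grows in
  the induction.\<close>

lemma cost_Down:
  assumes "is_chain \<alpha> (map Down [c..<c + n]) ps" "fin_supp \<alpha>"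
  shows "cost \<alpha> (map Down [c..<c + n]) ps = c * size_seq \<alpha> + sum_list (map size_seq ps)"
  using assms
proof (induction n arbitrary: c \<alpha> ps)
  case 0
  then show ?case by simp
next
  case (Suc n)
  have upt: "[c..<c + Suc n] = c # [Suc c..<Suc c + n]"
    by (simp add: upt_rec)
  obtain \<beta> qs where ps: "ps = \<beta> # qs" "\<beta> \<prec> \<alpha>" "is_chain \<beta> (map Down [Suc c..<Suc c + n]) qs"
    using Suc.prems(1) unfolding upt by auto
  have "cost \<beta> (map Down [Suc c..<Suc c + n]) qs = Suc c * size_seq \<beta> + sum_list (map size_seq qs)"
    by (rule Suc.IH) (use ps Suc.prems(2) interlace_fin_supp in auto)
  moreover have "c * (size_seq \<alpha> - size_seq \<beta>) + c * size_seq \<beta> = c * size_seq \<alpha>"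
    using size_seq_mono[OF ps(2) Suc.prems(2)] by (simp add: distrib_left[symmetric])
  ultimately show ?case
    unfolding upt ps(1) by simp
qed

text \<open>The start enters the cost with coefficient -n, written on the left to avoid truncated
  subtraction; it vanishes for chains from 0.\<close>

lemma cost_Up_Down:
  assumes "is_chain \<alpha> (map Up (rev [1..<Suc n]) @ map Down [0..<m]) ps" "fin_supp \<alpha>"
  shows "cost \<alpha> (map Up (rev [1..<Suc n]) @ map Down [0..<m]) ps + n * size_seq \<alpha> = sum_list (map size_seq ps)"
  using assms
proof (induction n arbitrary: \<alpha> ps)
  case 0
  then show ?case using cost_Down[of \<alpha> 0 m ps] by simp
next
  case (Suc n)
  have upt: "rev [1..<Suc (Suc n)] = Suc n # rev [1..<Suc n]"
    by simp
  obtain \<beta> qs where ps: "ps = \<beta> # qs" "\<alpha> \<prec> \<beta>" "is_chain \<beta> (map Up (rev [1..<Suc n]) @ map Down [0..<m]) qs"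
    using Suc.prems(1) unfolding upt by auto
  have \<beta>: "fin_supp \<beta>"
    using Suc.prems(2) ps(2) interlace_fin_supp by blast
  have "cost \<beta> (map Up (rev [1..<Suc n]) @ map Down [0..<m]) qs + n * size_seq \<beta> = sum_list (map size_seq qs)"
    by (rule Suc.IH) (use ps \<beta> in auto)
  moreover have "Suc n * (size_seq \<beta> - size_seq \<alpha>) + Suc n * size_seq \<alpha> = Suc n * size_seq \<beta>"
    using size_seq_mono[OF ps(2) \<beta>] by (simp only: distrib_left[symmetric]) simp
  ultimately show ?case
    unfolding upt ps(1) by simp
qed

text \<open>The recursive form suits rewriting of words, this one suits diagonals, which are given
  by index.\<close>

lemma is_chain_iff:
  "is_chain \<alpha> w ps \<longleftrightarrow> length ps = length w \<and>
     (\<forall>k<length w. step_rel (w ! k) ((\<alpha> # ps) ! k) ((\<alpha> # ps) ! Suc k)) \<and> (\<alpha> # ps) ! length w = (\<lambda>_. 0)"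
proof (induction w arbitrary: \<alpha> ps)
  case (Cons s w)
  then show ?case by (cases ps) (auto simp: All_less_Suc2)
qed auto

lemma is_chain_box_iff:
  "is_chain \<alpha> (box_word n) ps \<longleftrightarrow> length ps = 2 * n \<and>
     (\<forall>k<n. (\<alpha> # ps) ! k \<prec> (\<alpha> # ps) ! Suc k) \<and>
     (\<forall>k. n \<le> k \<and> k < 2 * n \<longrightarrow> (\<alpha> # ps) ! Suc k \<prec> (\<alpha> # ps) ! k) \<and> (\<alpha> # ps) ! (2 * n) = (\<lambda>_. 0)"
proof -
  have up: "box_word n ! k = Up (rev [1..<Suc n] ! k)" if "k < n" for k
    using that by (simp add: nth_append del: upt_Suc)
  have down: "box_word n ! k = Down (k - n)" if "n \<le> k" "k < 2 * n" for k
    using that by (simp add: nth_append del: upt_Suc)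
  have "(\<forall>k<2 * n. step_rel (box_word n ! k) ((\<alpha> # ps) ! k) ((\<alpha> # ps) ! Suc k)) \<longleftrightarrow>
     (\<forall>k<n. step_rel (box_word n ! k) ((\<alpha> # ps) ! k) ((\<alpha> # ps) ! Suc k)) \<and>
     (\<forall>k. n \<le> k \<and> k < 2 * n \<longrightarrow> step_rel (box_word n ! k) ((\<alpha> # ps) ! k) ((\<alpha> # ps) ! Suc k))"
    by (smt (verit) le_add1 mult_2 not_le order_less_le_trans)
  also have "\<dots> \<longleftrightarrow> (\<forall>k<n. (\<alpha> # ps) ! k \<prec> (\<alpha> # ps) ! Suc k) \<and>
     (\<forall>k. n \<le> k \<and> k < 2 * n \<longrightarrow> (\<alpha> # ps) ! Suc k \<prec> (\<alpha> # ps) ! k)"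
    by (simp only: up down step_rel.simps cong: conj_cong imp_cong)
  finally show ?thesis
    unfolding is_chain_iff by (simp add: mult_2 del: upt_Suc)
qed

section \<open>Passing between box partitions and their diagonals\<close>

definition box_partitions :: "nat \<Rightarrow> (nat \<Rightarrow> nat \<Rightarrow> nat) set" where
  "box_partitions n = {\<pi>. plane_partition \<pi> \<and> (\<forall>i j. \<pi> i j \<noteq> 0 \<longrightarrow> i < n \<and> j < n)}"

text \<open>At most one of the two truncated differences is nonzero; the main diagonal has index \<open>n\<close>.\<close>

definition diagonal :: "nat \<Rightarrow> (nat \<Rightarrow> nat \<Rightarrow> nat) \<Rightarrow> nat \<Rightarrow> nat \<Rightarrow> nat" where
  "diagonal n \<pi> k t = \<pi> (t + (k - n)) (t + (n - k))"

text \<open>Diagonal 0 lies outside the box and is the initial 0 of the chain, so it is not listed;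
  diagonal 2 * n is the final 0 and is.\<close>

definition diagonals :: "nat \<Rightarrow> (nat \<Rightarrow> nat \<Rightarrow> nat) \<Rightarrow> (nat \<Rightarrow> nat) list" where
  "diagonals n \<pi> = map (diagonal n \<pi>) [1..<Suc (2 * n)]"

definition from_diagonals :: "nat \<Rightarrow> (nat \<Rightarrow> nat) list \<Rightarrow> nat \<Rightarrow> nat \<Rightarrow> nat" where
  "from_diagonals n ps i j =
     (if i < n \<and> j < n then (((\<lambda>_. 0) # ps) ! (n + i - j)) (min i j) else 0)"

lemma diagonals_nth:
  assumes "\<pi> \<in> box_partitions n" "k \<le> 2 * n"
  shows "((\<lambda>_. 0) # diagonals n \<pi>) ! k = diagonal n \<pi> k"
proof (cases k)
  case 0
  have "\<pi> t (t + n) = 0" for t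
    using assms(1) unfolding box_partitions_def by force
  then show ?thesis using 0 by (auto simp: diagonal_def)
next
  case (Suc j)
  then show ?thesis using assms(2) by (simp add: diagonals_def del: upt_Suc)
qed

text \<open>Each interlacing inequality compares two adjacent entries, one inequality within a row
  and the other within a column.\<close>

lemma diagonals_chain:
  assumes "\<pi> \<in> box_partitions n"
  shows "is_chain (\<lambda>_. 0) (box_word n) (diagonals n \<pi>)"
proof -
  let ?F = "(\<lambda>_. 0) # diagonals n \<pi>"
  have dec: "\<pi> (Suc i) j \<le> \<pi> i j" "\<pi> i (Suc j) \<le> \<pi> i j" for i j
    using assms by (auto simp: box_partitions_def plane_partition_def)
  have "?F ! k \<prec> ?F ! Suc k" if k: "k < n" for k
  proof -
    obtain m where m: "n = Suc (k + m)"
      using less_imp_Suc_add[OF k] by blast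
    have "diagonal n \<pi> k \<prec> diagonal n \<pi> (Suc k)"
      using dec by (auto simp: interlace_def diagonal_def m Suc_diff_le)
    then show ?thesis
      using diagonals_nth[OF assms, of k] diagonals_nth[OF assms, of "Suc k"] k by simp
  qed
  moreover have "?F ! Suc k \<prec> ?F ! k" if k: "n \<le> k \<and> k < 2 * n" for k
  proof -
    obtain m where m: "k = n + m"
      using k le_Suc_ex by blast
    have "diagonal n \<pi> (Suc k) \<prec> diagonal n \<pi> k"
      using dec by (auto simp: interlace_def diagonal_def m Suc_diff_le)
    then show ?thesis
      using diagonals_nth[OF assms, of k] diagonals_nth[OF assms, of "Suc k"] k by simp
  qed
  moreover have "?F ! (2 * n) = (\<lambda>_. 0)"
    using assms by (auto simp: diagonals_nth diagonal_def fun_eq_iff box_partitions_def)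
  moreover have "length (diagonals n \<pi>) = 2 * n"
    by (simp add: diagonals_def)
  ultimately show ?thesis
    unfolding is_chain_box_iff by blast
qed

lemma from_diagonals_diagonals:
  assumes "\<pi> \<in> box_partitions n"
  shows "from_diagonals n (diagonals n \<pi>) = \<pi>"
proof (intro ext)
  fix i j
  show "from_diagonals n (diagonals n \<pi>) i j = \<pi> i j"
  proof (cases "i < n \<and> j < n")
    case True
    then have "min i j + (n + i - j - n) = i" "min i j + (n - (n + i - j)) = j"
      by auto
    moreover have "((\<lambda>_. 0) # diagonals n \<pi>) ! (n + i - j) = diagonal n \<pi> (n + i - j)"
      by (rule diagonals_nth[OF assms]) (use True in auto)
    ultimately show ?thesis
      using True unfolding from_diagonals_def diagonal_def by (simp only: if_True simp_thms)
  next
    case False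
    then show ?thesis
      using assms by (auto simp: from_diagonals_def box_partitions_def)
  qed
qed

context
  fixes n ps and F :: "nat \<Rightarrow> nat \<Rightarrow> nat"
  assumes chain: "is_chain (\<lambda>_. 0) (box_word n) ps"
  defines "F k \<equiv> ((\<lambda>_. 0) # ps) ! k"
begin

lemma chain_up: "k < n \<Longrightarrow> F k \<prec> F (Suc k)"
  using chain unfolding is_chain_box_iff F_def by blast

lemma chain_down: "n \<le> k \<Longrightarrow> k < 2 * n \<Longrightarrow> F (Suc k) \<prec> F k"
  using chain unfolding is_chain_box_iff F_def by blast

text \<open>An up step adds at most one part. With the mirror statement from the other end, this
  keeps the diagonals inside the box.\<close>

lemma chain_up_zero: "k \<le> n \<Longrightarrow> k \<le> t \<Longrightarrow> F k t = 0"
proof (induction k arbitrary: t)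
  case 0
  show ?case by (simp add: F_def)
next
  case (Suc k)
  obtain t' where t': "t = Suc t'"
    using Suc.prems by (cases t) auto
  have "F (Suc k) (Suc t') \<le> F k t'"
    using chain_up[of k] Suc.prems by (auto simp: interlace_def)
  then show ?case
    using Suc t' by simp
qed

lemma chain_down_zero: "m \<le> n \<Longrightarrow> m \<le> t \<Longrightarrow> F (2 * n - m) t = 0"
proof (induction m arbitrary: t)
  case 0
  show ?case using chain unfolding is_chain_box_iff F_def by simp
next
  case (Suc m)
  obtain t' where t': "t = Suc t'"
    using Suc.prems by (cases t) auto
  have "Suc (2 * n - Suc m) = 2 * n - m"
    using Suc.prems by simp
  then have "F (2 * n - Suc m) (Suc t') \<le> F (2 * n - m) t'"
    using chain_down[of "2 * n - Suc m"] Suc.prems by (auto simp: interlace_def)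
  then show ?case
    using Suc t' by simp
qed

lemma from_diagonals_F:
  "from_diagonals n ps i j = (if i < n \<and> j < n then F (n + i - j) (min i j) else 0)"
  by (simp add: from_diagonals_def F_def)

lemma from_diagonals_in_box: "from_diagonals n ps \<in> box_partitions n"
proof -
  let ?\<pi> = "from_diagonals n ps"
  have supp: "?\<pi> i j \<noteq> 0 \<Longrightarrow> i < n \<and> j < n" for i j
    by (auto simp: from_diagonals_def split: if_splits)
  have "finite {(i, j). ?\<pi> i j \<noteq> 0}"
    by (rule finite_subset[of _ "{..<n} \<times> {..<n}"]) (use supp in auto)
  moreover have "?\<pi> (Suc i) j \<le> ?\<pi> i j" for i j
  proof (cases "Suc i < n \<and> j < n")
    case True
    show ?thesis
    \<comment> \<open>On or below the main diagonal a step down the column moves away from it and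
      keeps the position j; above, it moves closer and the position advances, so the other
      inequality of \<open>\<prec>\<close> applies.\<close>
    proof (cases "j \<le> i")
      case le: True
      then have "F (Suc (n + i - j)) j \<le> F (n + i - j) j"
        using chain_down[of "n + i - j"] True by (auto simp: interlace_def)
      then show ?thesis
        using True le by (simp add: from_diagonals_F Suc_diff_le min_absorb2)
    next
      case False
      then have "F (Suc (n + i - j)) (Suc i) \<le> F (n + i - j) i"
        using chain_up[of "n + i - j"] True by (auto simp: interlace_def)
      then show ?thesis
        using True False by (simp add: from_diagonals_F Suc_diff_le min_absorb1)
    qed
  next
    case False
    then have "?\<pi> (Suc i) j = 0"
      unfolding from_diagonals_def by (simp only: if_False)
    then show ?thesis by simp
  qed
  moreover have "?\<pi> i (Suc j) \<le> ?\<pi> i j" for i j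
  proof (cases "i < n \<and> Suc j < n")
    case True
    show ?thesis
    proof (cases "i \<le> j")
      case le: True
      define k where "k = n + i - Suc j"
      have k: "k < n" "n + i - j = Suc k" "min i j = i" "min i (Suc j) = i"
        using True le by (auto simp: k_def)
      have "F k i \<le> F (Suc k) i"
        using chain_up[OF k(1)] by (simp add: interlace_def)
      then show ?thesis
        using True unfolding from_diagonals_F k_def[symmetric] k by simp
    next
      case False
      then obtain m where m: "i = Suc (j + m)"
        using less_imp_Suc_add[of j i] by auto
      have idx: "n + i - j = Suc (n + m)" "n + i - Suc j = n + m" "min i j = j" "min i (Suc j) = Suc j"
        using m by auto
      have "F (Suc (n + m)) \<prec> F (n + m)"
        by (rule chain_down) (use True m in auto)
      then have "F (n + m) (Suc j) \<le> F (Suc (n + m)) j"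
        by (simp add: interlace_def)
      then show ?thesis
        using True unfolding from_diagonals_F idx by simp
    qed
  next
    case False
    then have "?\<pi> i (Suc j) = 0"
      unfolding from_diagonals_def by (simp only: if_False)
    then show ?thesis by simp
  qed
  ultimately show ?thesis
    using supp by (auto simp: box_partitions_def plane_partition_def)
qed

lemma diagonals_from_diagonals: "diagonals n (from_diagonals n ps) = ps"
proof (rule nth_equalityI)
  have len: "length ps = 2 * n"
    using chain unfolding is_chain_box_iff by blast
  then show "length (diagonals n (from_diagonals n ps)) = length ps"
    by (simp add: diagonals_def)
  fix l assume "l < length (diagonals n (from_diagonals n ps))"
  then have l: "Suc l \<le> 2 * n"
    by (simp add: diagonals_def del: upt_Suc)
  have "diagonal n (from_diagonals n ps) k t = F k t" if "k \<le> 2 * n" for k t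
  proof (cases "t + (k - n) < n \<and> t + (n - k) < n")
    case True
    then have "n + (t + (k - n)) - (t + (n - k)) = k" "min (t + (k - n)) (t + (n - k)) = t"
      by auto
    then show ?thesis
      using True by (simp add: diagonal_def from_diagonals_F)
  next
    case False
    \<comment> \<open>Reconstruction writes 0 outside the box, so nothing may be lost there.\<close>
    have "F k t = 0"
    proof (cases "k \<le> n")
      case True
      then show ?thesis using False by (intro chain_up_zero) auto
    next
      case k: False
      then show ?thesis
        using chain_down_zero[of "2 * n - k" t] False that by auto
    qed
    then show ?thesis
      using False by (auto simp: diagonal_def from_diagonals_F)
  qed
  then have "diagonal n (from_diagonals n ps) (Suc l) = F (Suc l)"
    using l by blast
  then show "diagonals n (from_diagonals n ps) ! l = ps ! l"
    using l by (simp add: diagonals_def F_def del: upt_Suc)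
qed

end

text \<open>Cell (i, j) is entry min i j of diagonal n + i - j, an index between 1 and 2 * n - 1
  inside the box.\<close>

lemma pp_size_diagonals:
  assumes "\<pi> \<in> box_partitions n"
  shows "pp_size \<pi> = sum_list (map size_seq (diagonals n \<pi>))"
proof -
  let ?D = "diagonal n \<pi>"
  have supp: "\<pi> i j \<noteq> 0 \<Longrightarrow> i < n \<and> j < n" for i j
    using assms by (auto simp: box_partitions_def)
  have fin: "finite {t. ?D k t \<noteq> 0}" for k
    by (rule finite_subset[of _ "{..<n}"]) (use supp in \<open>fastforce simp: diagonal_def\<close>)+
  have "pp_size \<pi> = (\<Sum>(k, t)\<in>Sigma {1..<Suc (2 * n)} (\<lambda>k. {t. ?D k t \<noteq> 0}). ?D k t)"
    unfolding pp_size_def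
  proof (rule sum.reindex_bij_witness[where i = "\<lambda>(k, t). (t + (k - n), t + (n - k))"
        and j = "\<lambda>(i, j). (n + i - j, min i j)"])
    fix x assume "x \<in> {(i, j). \<pi> i j \<noteq> 0}"
    then obtain i j where x: "x = (i, j)" "\<pi> i j \<noteq> 0" by auto
    then have ij: "i < n" "j < n" using supp by auto
    then have *: "min i j + (n + i - j - n) = i" "min i j + (n - (n + i - j)) = j" by auto
    show "(case case x of (i, j) \<Rightarrow> (n + i - j, min i j) of (k, t) \<Rightarrow> (t + (k - n), t + (n - k))) = x"
      "(case x of (i, j) \<Rightarrow> (n + i - j, min i j)) \<in> Sigma {1..<Suc (2 * n)} (\<lambda>k. {t. ?D k t \<noteq> 0})"
      "(case case x of (i, j) \<Rightarrow> (n + i - j, min i j) of (k, t) \<Rightarrow> ?D k t) = (case x of (i, j) \<Rightarrow> \<pi> i j)"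
      using x ij * by (auto simp: diagonal_def)
  next
    fix y assume "y \<in> Sigma {1..<Suc (2 * n)} (\<lambda>k. {t. ?D k t \<noteq> 0})"
    then obtain k t where y: "y = (k, t)" "\<pi> (t + (k - n)) (t + (n - k)) \<noteq> 0"
      by (auto simp: diagonal_def)
    show "(case case y of (k, t) \<Rightarrow> (t + (k - n), t + (n - k)) of (i, j) \<Rightarrow> (n + i - j, min i j)) = y"
      "(case y of (k, t) \<Rightarrow> (t + (k - n), t + (n - k))) \<in> {(i, j). \<pi> i j \<noteq> 0}"
      using y by auto
  qed
  also have "\<dots> = (\<Sum>k\<in>{1..<Suc (2 * n)}. size_seq (?D k))"
    unfolding size_seq_def by (subst sum.Sigma) (use fin in auto)
  also have "\<dots> = sum_list (map size_seq (diagonals n \<pi>))"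
    unfolding diagonals_def by (simp add: comp_def sum_list_distinct_conv_sum_set del: upt_Suc)
  finally show ?thesis .
qed

lemma weq_box_partitions_msets:
  "weq (box_partitions n) pp_size (msets ({1..n} \<times> {0..<n})) weight"
proof -
  have "weq (box_partitions n) pp_size (chains (\<lambda>_. 0) (box_word n)) (cost (\<lambda>_. 0) (box_word n))"
  proof (rule weqI[where h = "diagonals n" and h' = "from_diagonals n"])
    fix \<pi> assume \<pi>: "\<pi> \<in> box_partitions n"
    have "cost (\<lambda>_. 0) (box_word n) (diagonals n \<pi>) = pp_size \<pi>"
      using cost_Up_Down[OF diagonals_chain[OF \<pi>]] pp_size_diagonals[OF \<pi>] by (simp add: fin_supp_def)
    then show "diagonals n \<pi> \<in> chains (\<lambda>_. 0) (box_word n) \<and> from_diagonals n (diagonals n \<pi>) = \<pi> \<and>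
        cost (\<lambda>_. 0) (box_word n) (diagonals n \<pi>) = pp_size \<pi>"
      using diagonals_chain[OF \<pi>] from_diagonals_diagonals[OF \<pi>] by blast
  next
    fix ps assume "ps \<in> chains (\<lambda>_. 0) (box_word n)"
    then show "from_diagonals n ps \<in> box_partitions n \<and> diagonals n (from_diagonals n ps) = ps"
      using from_diagonals_in_box diagonals_from_diagonals by blast
  qed
  moreover have "weq (chains (\<lambda>_. 0) (box_word n)) (cost (\<lambda>_. 0) (box_word n))
      (msets (set (rev [1..<Suc n]) \<times> set [0..<n])) weight"
    by (rule weq_chains_msets) auto
  moreover have "set (rev [1..<Suc n]) = {1..n}" by auto
  ultimately show ?thesis
    using weq_trans by fastforce
qed

section \<open>Reduction to a finite box\<close>

text \<open>A nonzero entry at (i, j) forces i + 1 nonzero entries in its column and j + 1 in its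
  row, each contributing at least 1 to the size.\<close>

lemma plane_partition_in_box:
  assumes "plane_partition \<pi>" "pp_size \<pi> \<le> n"
  shows "\<pi> \<in> box_partitions n"
proof -
  let ?S = "{(i, j). \<pi> i j \<noteq> 0}"
  have fin: "finite ?S"
    using assms by (auto simp: plane_partition_def)
  have dec: "i' \<le> i \<Longrightarrow> \<pi> i j \<le> \<pi> i' j" "j' \<le> j \<Longrightarrow> \<pi> i j \<le> \<pi> i j'" for i i' j j'
    using assms(1) lift_Suc_antimono_le[of "\<lambda>i. \<pi> i j"] lift_Suc_antimono_le[of "\<pi> i"]
    by (auto simp: plane_partition_def)
  have "card ?S \<le> pp_size \<pi>"
    unfolding pp_size_def card_eq_sum by (rule sum_mono) auto
  then have card: "card A \<le> n" if "A \<subseteq> ?S" for A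
    using card_mono[OF fin that] assms(2) by linarith
  have "i < n \<and> j < n" if "\<pi> i j \<noteq> 0" for i j
  proof -
    have "{..i} \<times> {j} \<subseteq> ?S" "{i} \<times> {..j} \<subseteq> ?S"
      using dec(1)[of _ i j] dec(2)[of _ j i] that by fastforce+
    from this[THEN card] show ?thesis by simp
  qed
  then show ?thesis
    using assms(1) by (auto simp: box_partitions_def)
qed

lemma weight_ge:
  assumes "(p, q) \<in># M"
  shows "p + q \<le> weight M"
  using multi_member_split[OF assms] by auto

text \<open>From p \<ge> 1 and p + q \<le> n follows q < n, so the box is exactly the one given by
  the step weights.\<close>

lemma msets_in_box:
  assumes "weight M \<le> n"
  shows "set_mset M \<subseteq> {1..} \<times> UNIV \<longleftrightarrow> set_mset M \<subseteq> {1..n} \<times> {0..<n}"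
  using weight_ge[of _ _ M] assms by fastforce

text \<open>\<open>JNpm\<close> sums over the union of two supports; an arbitrary finite A lets that
  sum separate into two weights.\<close>

lemma sum_count_eq_weight:
  assumes "finite A" "set_mset M \<subseteq> A"
  shows "(\<Sum>(p, q)\<in>A. count M (p, q) * (p + q)) = weight M"
  using assms(2)
proof (induction M)
  case empty
  show ?case by simp
next
  case (add x M)
  have "(\<Sum>y\<in>A. count (add_mset x M) y * (fst y + snd y)) =
      (\<Sum>y\<in>A. count M y * (fst y + snd y) + (if y = x then fst x + snd x else 0))"
    by (rule sum.cong) auto
  also have "\<dots> = weight M + (fst x + snd x)"
    using add assms(1) by (simp add: sum.distrib case_prod_unfold)
  also have "\<dots> = weight (add_mset x M)"
    by (cases x) simp
  finally show ?case
    unfolding case_prod_unfold prod.collapse .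
qed

lemma JNpm_eq:
  "JNpm N = {x \<in> msets ({1..N} \<times> {0..<N}) \<times> msets ({1..N} \<times> {0..<N}).
     (case x of (f, g) \<Rightarrow> weight f + weight g) = N}"
proof -
  have "(\<Sum>(p, q)\<in>set_mset f \<union> set_mset g. (count f (p, q) + count g (p, q)) * (p + q)) = weight f + weight g" for f g
    using sum_count_eq_weight[of "set_mset f \<union> set_mset g"]
    by (simp add: add_mult_distrib sum.distrib case_prod_unfold)
  then have "JNpm N = {(f, g). set_mset f \<subseteq> {1..} \<times> UNIV \<and> set_mset g \<subseteq> {1..} \<times> UNIV \<and> weight f + weight g = N}"
    unfolding JNpm_def by simp
  also have "\<dots> = {(f, g). set_mset f \<subseteq> {1..N} \<times> {0..<N} \<and> set_mset g \<subseteq> {1..N} \<times> {0..<N} \<and> weight f + weight g = N}"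
  proof -
    have *: "set_mset f \<subseteq> {1..} \<times> UNIV \<and> set_mset g \<subseteq> {1..} \<times> UNIV \<and> weight f + weight g = N \<longleftrightarrow>
        set_mset f \<subseteq> {1..N} \<times> {0..<N} \<and> set_mset g \<subseteq> {1..N} \<times> {0..<N} \<and> weight f + weight g = N" for f g
    proof (cases "weight f + weight g = N")
      case True
      then have "weight f \<le> N" "weight g \<le> N" by auto
      then show ?thesis by (simp only: msets_in_box)
    qed simp
    show ?thesis by (simp only: *)
  qed
  finally show ?thesis by auto
qed

lemma plane_partition_pairs_eq:
  "plane_partition_pairs N = {x \<in> box_partitions N \<times> box_partitions N. (case x of (\<pi>, \<rho>) \<Rightarrow> pp_size \<pi> + pp_size \<rho>) = N}"
  using plane_partition_in_box[of _ N] unfolding plane_partition_pairs_def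
  by (auto simp: box_partitions_def)

lemma plane_partition_pairs_bij_JNpm: "\<exists>h. bij_betw h (plane_partition_pairs N) (JNpm N)"
  unfolding JNpm_eq plane_partition_pairs_eq
  by (rule weq_level_bij[OF weq_times[OF weq_box_partitions_msets weq_box_partitions_msets]])

section \<open>Counting multisets\<close>

text \<open>Equal entries at different positions are different coins, as are distinct pairs of equal
  degree. The test for 0 makes the recursion terminate.\<close>

fun coin_change :: "nat list \<Rightarrow> nat \<Rightarrow> nat" where
  "coin_change [] N = (if N = 0 then 1 else 0)"
| "coin_change (w # ws) N = coin_change ws N + (if w = 0 \<or> N < w then 0 else coin_change (w # ws) (N - w))"

abbreviation level :: "(nat \<times> nat) set \<Rightarrow> nat \<Rightarrow> (nat \<times> nat) multiset set" where
  "level A N \<equiv> {M \<in> msets A. weight M = N}"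

text \<open>Either e is absent or one copy of it can be removed. A pair of degree 0 could be
  repeated at will and would make the levels infinite.\<close>

lemma level_card:
  assumes "distinct es" "(0, 0) \<notin> set es"
  shows "finite (level (set es) N) \<and> card (level (set es) N) = coin_change (map (\<lambda>(p, q). p + q) es) N"
  using assms
proof (induction es arbitrary: N)
  case Nil
  have "level (set []) N = (if N = 0 then {{#}} else {})" by auto
  then show ?case by simp
next
  case (Cons e es)
  obtain p q where e: "e = (p, q)" by force
  have pos: "p + q > 0" using Cons.prems e by auto
  have IH: "finite (level (set es) N)" "card (level (set es) N) = coin_change (map (\<lambda>(p, q). p + q) es) N" for N
    using Cons by auto
  show ?case
  \<comment> \<open>Removing a copy of e keeps the list and lowers only N, so a second induction is
    needed.\<close>
  proof (induction N rule: less_induct)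
    case (less N)
    let ?L = "level (set (e # es))" and ?c = "coin_change (map (\<lambda>(p, q). p + q) (e # es))"
    let ?R = "{M \<in> ?L N. e \<in># M}"
    have split: "?L N = level (set es) N \<union> ?R"
      by auto
    have disj: "level (set es) N \<inter> ?R = {}"
      using Cons.prems by auto
    have R: "?R = (if N < p + q then {} else add_mset e ` ?L (N - (p + q)))"
    proof (cases "N < p + q")
      case True
      then show ?thesis using weight_ge e by fastforce
    next
      case False
      have "?R = add_mset e ` ?L (N - (p + q))"
      proof (intro subset_antisym subsetI)
        fix M assume M: "M \<in> ?R"
        then obtain M' where M': "M = add_mset e M'" using multi_member_split[of e M] by blast
        have "M' \<in> ?L (N - (p + q))"
          using M unfolding M' e by auto
        then show "M \<in> add_mset e ` ?L (N - (p + q))" unfolding M' by (rule imageI)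
      next
        fix M assume "M \<in> add_mset e ` ?L (N - (p + q))"
        then obtain M' where "M = add_mset e M'" "M' \<in> ?L (N - (p + q))" by blast
        then show "M \<in> ?R" using False e by auto
      qed
      then show ?thesis using False by (simp only: if_False)
    qed
    have card_R: "finite ?R \<and> card ?R = (if N < p + q then 0 else ?c (N - (p + q)))"
    proof (cases "N < p + q")
      case True
      then have "?R = {}" unfolding R by (simp only: if_True)
      then show ?thesis using True by (simp only: finite.emptyI card.empty if_True simp_thms)
    next
      case False
      then have "?R = add_mset e ` ?L (N - (p + q))" unfolding R by (simp only: if_False)
      moreover have "finite (?L (N - (p + q))) \<and> card (?L (N - (p + q))) = ?c (N - (p + q))"
        by (rule less.IH) (use False pos in linarith)
      moreover have "inj_on (add_mset e) A" for A
        by (rule inj_onI) simp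
      ultimately show ?thesis
        using False by (simp only: card_image finite_imageI if_False simp_thms)
    qed
    have "(p + q = 0) = False"
      using pos by simp
    then have "?c N = coin_change (map (\<lambda>(p, q). p + q) es) N + (if N < p + q then 0 else ?c (N - (p + q)))"
      unfolding e list.map prod.case by (subst coin_change.simps(2)) (simp only: simp_thms)
    moreover have "card (?L N) = card (level (set es) N) + card ?R"
      using card_Un_disjoint[OF IH(1) conjunct1[OF card_R] disj] unfolding split[symmetric] .
    moreover have "finite (?L N)"
      using finite_UnI[OF IH(1)[of N] conjunct1[OF card_R]] unfolding split[symmetric] .
    ultimately show ?case
      using IH[of N] card_R by (simp only:)
  qed
qed

section \<open>Convolution of levels and the first values\<close>

lemma level_box_eq:
  assumes "k \<le> N" "k \<le> m"
  shows "level ({1..N} \<times> {0..<N}) k = level ({1..m} \<times> {0..<m}) k"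
proof -
  have *: "set_mset M \<subseteq> {1..N} \<times> {0..<N} \<longleftrightarrow> set_mset M \<subseteq> {1..m} \<times> {0..<m}" if "weight M = k" for M
    by (rule trans[OF msets_in_box[symmetric] msets_in_box]) (use assms that in auto)
  show ?thesis
  proof (intro Collect_cong)
    fix M
    show "M \<in> msets ({1..N} \<times> {0..<N}) \<and> weight M = k \<longleftrightarrow> M \<in> msets ({1..m} \<times> {0..<m}) \<and> weight M = k"
      using *[of M] by (cases "weight M = k") (simp_all only: mem_Collect_eq simp_thms)
  qed
qed

text \<open>Splitting by the weight k of the first multiset gives a convolution. A common box m for
  all N \<le> m lets one table of level sizes serve all the values.\<close>

lemma JNpm_levels:
  assumes "N \<le> m"
  shows "finite (JNpm N)"
    and "card (JNpm N) =
      (\<Sum>k\<le>N. card (level ({1..m} \<times> {0..<m}) k) * card (level ({1..m} \<times> {0..<m}) (N - k)))"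
proof -
  let ?L = "level ({1..m} \<times> {0..<m})"
  obtain es where es: "set es = {1..m} \<times> {0..<m}" "distinct es"
    using finite_distinct_list[of "{1..m} \<times> {0..<m}"] by auto
  have fin: "finite (?L k)" for k
    using level_card[OF es(2), of k] unfolding es(1) by auto
  have "JNpm N = (\<Union>k\<in>{..N}. level ({1..N} \<times> {0..<N}) k \<times> level ({1..N} \<times> {0..<N}) (N - k))"
    unfolding JNpm_eq by auto
  also have "\<dots> = (\<Union>k\<in>{..N}. ?L k \<times> ?L (N - k))"
  proof (rule SUP_cong[OF refl])
    fix k assume k: "k \<in> {..N}"
    have "level ({1..N} \<times> {0..<N}) k = ?L k" "level ({1..N} \<times> {0..<N}) (N - k) = ?L (N - k)"
      by (rule level_box_eq; use assms k in simp)+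
    then show "level ({1..N} \<times> {0..<N}) k \<times> level ({1..N} \<times> {0..<N}) (N - k) = ?L k \<times> ?L (N - k)"
      by (simp only:)
  qed
  finally have eq: "JNpm N = (\<Union>k\<in>{..N}. ?L k \<times> ?L (N - k))" .
  show "finite (JNpm N)"
    unfolding eq using fin by auto
  show "card (JNpm N) = (\<Sum>k\<le>N. card (?L k) * card (?L (N - k)))"
    unfolding eq by (subst card_UN_disjoint) (use fin in \<open>auto simp: card_cartesian_product\<close>)
qed

theorem mainTheorem2:
  "(\<forall>N. finite (JNpm N) \<and> finite (plane_partition_pairs N) \<and>
        card (JNpm N) = card (plane_partition_pairs N)) \<and>
   map (\<lambda>N. card (JNpm N)) [0, 1, 2, 3, 4, 5] = [1, 2, 7, 18, 47, 110]"
proof (intro conjI allI)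
  fix N
  show "finite (JNpm N)"
    using JNpm_levels(1) by blast
  then show "finite (plane_partition_pairs N)" "card (JNpm N) = card (plane_partition_pairs N)"
    using plane_partition_pairs_bij_JNpm[of N] bij_betw_finite bij_betw_same_card by metis+
next
  let ?es = "List.product [1..<6] [0..<5]"
  have "set ?es = {1..5} \<times> {0..<5}" by auto
  then have "card (level ({1..5} \<times> {0..<5}) k) = coin_change (map (\<lambda>(p, q). p + q) ?es) k" for k
    using level_card[of ?es k] distinct_product[of "[1..<6]" "[0..<5]"] by auto
  \<comment> \<open>These are the numbers of plane partitions of 0, ..., 5; convolving the list with
    itself gives the claimed values.\<close>
  moreover have "map (coin_change (map (\<lambda>(p, q). p + q) ?es)) [0, 1, 2, 3, 4, 5] = [1, 1, 3, 6, 13, 24]"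
    by code_simp
  ultimately have "map (\<lambda>k. card (level ({1..5} \<times> {0..<5}) k)) [0, 1, 2, 3, 4, 5] = [1, 1, 3, 6, 13, 24]"
    by simp
  then show "map (\<lambda>N. card (JNpm N)) [0, 1, 2, 3, 4, 5] = [1, 2, 7, 18, 47, 110]"
    by (simp add: JNpm_levels(2)[of _ 5] numeral_eq_Suc)
qed

end
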